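(* The context distance of $\Lambda_\oplus^{!,\parallel}$ trivialises: for every type $\sigma$ and all closed terms $M,N$ of $\Lambda_\oplus^{!,\parallel}$ with $\vdash M:\sigma$ and $\vdash N:\sigma$, one has $\delta^{c}_{!,\parallel,\,!\sigma}(!M,!N)\in\{0,1\}$.
   Context: The terms of $\Lambda_\oplus^{!,\parallel}$ over a countable set of variables are given by $M ::= x \mid MM \mid \lambda x.M \mid \lambda !x.M \mid\ !M \mid M\oplus M \mid \mathsf{por}(M,M,M)$ (linear abstraction, non-linear abstraction, exponential box, fair probabilistic choice, parallel disjunction). Values: $V ::= \lambda x.M \mid \lambda !x.M \mid\ !M$. Evaluation contexts: $E ::= [\cdot] \mid EV \mid ME \mid \mathsf{por}(M,E,N) \mid \mathsf{por}(E,M,N)$. One-step reduction relates a closed term to a finite sequence of closed terms: $M\oplus N \to M,N$; $(\lambda x.M)V \to M\{V/x\}$; $(\lambda !x.M)(!N) \to M\{N/x\}$; $\mathsf{por}(V,M,N)\to N$; $\mathsf{por}(M,V,N)\to N$; and if $M\to N_1,\dots,N_n$ by a base rule then $E[M]\to E[N_1],\dots,E[N_n]$. The approximation semantics $M\Rightarrow\mathcal D$ is inductively defined by: $V\Rightarrow\{V^1\}$; $M\Rightarrow\emptyset$; if $M\to N_1,\dots,N_n$ and $N_i\Rightarrow\mathcal D_i$ for all $i$ then $M\Rightarrow\sum_i\frac1n\mathcal D_i$. The semantics $[\![M]\!]$ is the (pointwise) supremum of all $\mathcal D$ with $M\Rightarrow\mathcal D$, and $\mathrm{Obs}(M)=\sum_V[\![M]\!](V)$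 is the probability of convergence. Types: $\sigma ::= \alpha \mid \mu\alpha.(\sigma\multimap\sigma) \mid \mu\alpha.!\sigma \mid \sigma\multimap\sigma \mid\ !\sigma$ modulo the equality $=_T$ generated by unfolding $\mu\alpha.(\sigma\multimap\tau) =_T (\sigma\multimap\tau)[\mu\alpha.(\sigma\multimap\tau)/\alpha]$, $\mu\alpha.!\sigma=_T\ !(\sigma[\mu\alpha.!\sigma/\alpha])$, and uniqueness of fixed points (if $\sigma=_T\gamma[\sigma/\alpha]$ and $\tau=_T\gamma[\tau/\alpha]$ then $\sigma=_T\tau$). Environments $!\Gamma,\Delta$: $!\Gamma$ declarations $!x:!\sigma$, $\Delta$ declarations $x:\sigma$. Typing rules: $!\Gamma,!x:!\sigma\vdash x:\sigma$; $!\Gamma,x:\sigma\vdash x:\sigma$; $!\Gamma,x:\sigma,\Delta\vdash M:\tau \Rightarrow\ !\Gamma,\Delta\vdash\lambda x.M:\sigma\multimap\tau$; $!\Gamma,!x:!\sigma,\Delta\vdash M:\tau\Rightarrow\ !\Gamma,\Delta\vdash\lambda!x.M:\ !\sigma\multimap\tau$; $!\Gamma,\Delta\vdash M:\sigma\multimap\tau$ and $!\Gamma,\Theta\vdash N:\sigma$ $\Rightarrow$ $!\Gamma,\Delta,\Theta\vdash MN:\tau$; $!\Gamma\vdash M:\sigma\Rightarrow\ !\Gamma\vdash\ !M:\ !\sigma$; $!\Gamma,\Delta\vdash M:\sigma$ and $!\Gamma,\Delta\vdash N:\sigma$ $\Rightarrow$ $!\Gamma,\Delta\vdash M\oplus N:\sigma$;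 $!\Gamma,\Delta\vdash M:\sigma$, $!\Gamma,\Theta\vdash N:\sigma$, $!\Gamma,\Xi\vdash L:\tau$ $\Rightarrow$ $!\Gamma,\Delta,\Theta,\Xi\vdash\mathsf{por}(M,N,L):\tau$. Context distance: for closed $M,N$ with $\vdash M:\sigma$, $\vdash N:\sigma$, $\delta^c_{!,\parallel,\sigma}(M,N)=\sup|\mathrm{Obs}(C\{M/h\})-\mathrm{Obs}(C\{N/h\})|$, the supremum ranging over all types $\tau$ and all terms $C$ of $\Lambda_\oplus^{!,\parallel}$ with $h:\sigma\vdash C:\tau$, where $h$ is a distinguished variable declared linearly. *)

theory Defs
  imports "HOL-Analysis.Infinite_Sum"
begin

section \<open>Terms\<close>

text \<open>
  Terms up to renaming of bound variables, in de Bruijn style: \<open>Lam\<close> (linear abstraction) and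
  \<open>LamB\<close> (non-linear abstraction \<open>\<lambda>!x.M\<close>) bind index 0 of their body.
\<close>

datatype trm =
    Var nat
  | App trm trm
  | Lam trm
  | LamB trm
  | Box trm
  | Choice trm trm
  | Por trm trm trm

primrec free_vars :: "trm \<Rightarrow> nat set" where
  "free_vars (Var i) = {i}"
| "free_vars (App M N) = free_vars M \<union> free_vars N"
| "free_vars (Lam M) = {i. Suc i \<in> free_vars M}"
| "free_vars (LamB M) = {i. Suc i \<in> free_vars M}"
| "free_vars (Box M) = free_vars M"
| "free_vars (Choice M N) = free_vars M \<union> free_vars N"
| "free_vars (Por M N L) = free_vars M \<union> free_vars N \<union> free_vars L"

definition closed_trm :: "trm \<Rightarrow> bool" where
  "closed_trm M \<longleftrightarrow> free_vars M = {}"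

primrec lift_trm :: "trm \<Rightarrow> nat \<Rightarrow> trm" where
  "lift_trm (Var i) k = (if i < k then Var i else Var (Suc i))"
| "lift_trm (App M N) k = App (lift_trm M k) (lift_trm N k)"
| "lift_trm (Lam M) k = Lam (lift_trm M (Suc k))"
| "lift_trm (LamB M) k = LamB (lift_trm M (Suc k))"
| "lift_trm (Box M) k = Box (lift_trm M k)"
| "lift_trm (Choice M N) k = Choice (lift_trm M k) (lift_trm N k)"
| "lift_trm (Por M N L) k = Por (lift_trm M k) (lift_trm N k) (lift_trm L k)"

text \<open>
  \<open>subst_trm M k S\<close> replaces index \<open>k\<close> by \<open>S\<close> and removes \<open>k\<close> from the environment (larger
  indices are decremented).
\<close>

primrec subst_trm :: "trm \<Rightarrow> nat \<Rightarrow> trm \<Rightarrow> trm" where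
  "subst_trm (Var i) k S = (if i < k then Var i else if i = k then S else Var (i - 1))"
| "subst_trm (App M N) k S = App (subst_trm M k S) (subst_trm N k S)"
| "subst_trm (Lam M) k S = Lam (subst_trm M (Suc k) (lift_trm S 0))"
| "subst_trm (LamB M) k S = LamB (subst_trm M (Suc k) (lift_trm S 0))"
| "subst_trm (Box M) k S = Box (subst_trm M k S)"
| "subst_trm (Choice M N) k S = Choice (subst_trm M k S) (subst_trm N k S)"
| "subst_trm (Por M N L) k S = Por (subst_trm M k S) (subst_trm N k S) (subst_trm L k S)"

primrec is_value :: "trm \<Rightarrow> bool" where
  "is_value (Var i) = False"
| "is_value (App M N) = False"
| "is_value (Lam M) = True"
| "is_value (LamB M) = True"
| "is_value (Box M) = True"
| "is_value (Choice M N) = False"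
| "is_value (Por M N L) = False"


section \<open>Operational semantics\<close>

text \<open>
  Evaluation contexts bind no variables, so they are represented by their plugging functions.
\<close>

inductive eval_ctx :: "(trm \<Rightarrow> trm) \<Rightarrow> bool" where
  hole: "eval_ctx (\<lambda>M. M)"
| app_fun: "eval_ctx E \<Longrightarrow> is_value V \<Longrightarrow> eval_ctx (\<lambda>M. App (E M) V)"
| app_arg: "eval_ctx E \<Longrightarrow> eval_ctx (\<lambda>M. App L (E M))"
| por_right: "eval_ctx E \<Longrightarrow> eval_ctx (\<lambda>M. Por L (E M) N)"
| por_left: "eval_ctx E \<Longrightarrow> eval_ctx (\<lambda>M. Por (E M) L N)"

inductive base_step :: "trm \<Rightarrow> trm list \<Rightarrow> bool" where
  choice: "base_step (Choice M N) [M, N]"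
| beta_lin: "is_value V \<Longrightarrow> base_step (App (Lam M) V) [subst_trm M 0 V]"
| beta_exp: "base_step (App (LamB M) (Box N)) [subst_trm M 0 N]"
| por_left: "is_value V \<Longrightarrow> base_step (Por V M N) [N]"
| por_right: "is_value V \<Longrightarrow> base_step (Por M V N) [N]"

text \<open>
  The rules are stated for arbitrary terms but are only used on closed ones: the hole of an
  evaluation context is under no binder, so redexes and reducts of a closed term are closed.
\<close>

inductive step :: "trm \<Rightarrow> trm list \<Rightarrow> bool" where
  "base_step M Ns \<Longrightarrow> eval_ctx E \<Longrightarrow> step (E M) (map E Ns)"

inductive approx :: "trm \<Rightarrow> (trm \<Rightarrow> real) \<Rightarrow> bool" where
  val: "is_value V \<Longrightarrow> approx V (\<lambda>W. if W = V then 1 else 0)"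
| empty: "approx M (\<lambda>W. 0)"
| step: "step M Ns \<Longrightarrow> list_all2 approx Ns Ds \<Longrightarrow>
    approx M (\<lambda>W. \<Sum>D\<leftarrow>Ds. 1 / real (length Ns) * D W)"

definition sem :: "trm \<Rightarrow> trm \<Rightarrow> real" where
  "sem M V = (SUP D \<in> {D. approx M D}. D V)"

definition Obs :: "trm \<Rightarrow> real" where
  "Obs M = (\<Sum>\<^sub>\<infinity>V \<in> {V. is_value V}. sem M V)"


section \<open>Types\<close>

text \<open>
  Raw types, again in de Bruijn style: \<open>RMuArr \<sigma> \<tau>\<close> is \<open>\<mu>\<alpha>.(\<sigma> \<multimap> \<tau>)\<close> and \<open>RMuBang \<sigma>\<close> is
  \<open>\<mu>\<alpha>.!\<sigma>\<close>, with \<open>\<alpha>\<close> being index 0 in the components.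
\<close>

datatype rty =
    RVar nat
  | RMuArr rty rty
  | RMuBang rty
  | RArr rty rty
  | RBang rty

primrec lift_rty :: "rty \<Rightarrow> nat \<Rightarrow> rty" where
  "lift_rty (RVar i) k = (if i < k then RVar i else RVar (Suc i))"
| "lift_rty (RMuArr s t) k = RMuArr (lift_rty s (Suc k)) (lift_rty t (Suc k))"
| "lift_rty (RMuBang s) k = RMuBang (lift_rty s (Suc k))"
| "lift_rty (RArr s t) k = RArr (lift_rty s k) (lift_rty t k)"
| "lift_rty (RBang s) k = RBang (lift_rty s k)"

primrec subst_rty :: "rty \<Rightarrow> nat \<Rightarrow> rty \<Rightarrow> rty" where
  "subst_rty (RVar i) k r = (if i < k then RVar i else if i = k then r else RVar (i - 1))"
| "subst_rty (RMuArr s t) k r =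
    RMuArr (subst_rty s (Suc k) (lift_rty r 0)) (subst_rty t (Suc k) (lift_rty r 0))"
| "subst_rty (RMuBang s) k r = RMuBang (subst_rty s (Suc k) (lift_rty r 0))"
| "subst_rty (RArr s t) k r = RArr (subst_rty s k r) (subst_rty t k r)"
| "subst_rty (RBang s) k r = RBang (subst_rty s k r)"

text \<open>
  In the rule for uniqueness of fixed points, \<open>g\<close> must be guarded in the variable \<open>\<alpha>\<close> (index 0)
  that is replaced; otherwise \<open>g = \<alpha>\<close> would identify all types. As every type constructor
  guards, \<open>\<alpha>\<close> itself is the only unguarded case.
\<close>

inductive teq :: "rty \<Rightarrow> rty \<Rightarrow> bool" where
  refl: "teq s s"
| sym: "teq s t \<Longrightarrow> teq t s"
| trans: "teq r s \<Longrightarrow> teq s t \<Longrightarrow> teq r t"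
| cong_arr: "teq s s' \<Longrightarrow> teq t t' \<Longrightarrow> teq (RArr s t) (RArr s' t')"
| cong_bang: "teq s s' \<Longrightarrow> teq (RBang s) (RBang s')"
| cong_mu_arr: "teq s s' \<Longrightarrow> teq t t' \<Longrightarrow> teq (RMuArr s t) (RMuArr s' t')"
| cong_mu_bang: "teq s s' \<Longrightarrow> teq (RMuBang s) (RMuBang s')"
| unfold_arr: "teq (RMuArr s t) (subst_rty (RArr s t) 0 (RMuArr s t))"
| unfold_bang: "teq (RMuBang s) (RBang (subst_rty s 0 (RMuBang s)))"
| unique_fix: "g \<noteq> RVar 0 \<Longrightarrow> teq s (subst_rty g 0 s) \<Longrightarrow> teq t (subst_rty g 0 t) \<Longrightarrow> teq s t"

quotient_type ty = rty / teq
  by (intro equivpI reflpI sympI transpI) (blast intro: teq.intros)+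

lift_definition Arr :: "ty \<Rightarrow> ty \<Rightarrow> ty" is RArr
  by (rule teq.cong_arr)

lift_definition Bang :: "ty \<Rightarrow> ty" is RBang
  by (rule teq.cong_bang)


section \<open>Typing\<close>

text \<open>
  In \<open>typing G D M \<tau>\<close>, \<open>G i = Some \<sigma>\<close> is the non-linear declaration \<open>!x : !\<sigma>\<close> and
  \<open>D i = Some \<sigma>\<close> the linear declaration \<open>x : \<sigma>\<close>, for the variable \<open>x\<close> with index \<open>i\<close>. The
  premise of \<open>lin\<close> keeps the two parts of an environment disjoint. Below a binder, index 0 is the
  bound variable and the declarations of the outer environment are shifted by one, which is
  what \<open>case_nat\<close> does.
\<close>

inductive typing :: "(nat \<rightharpoonup> ty) \<Rightarrow> (nat \<rightharpoonup> ty) \<Rightarrow> trm \<Rightarrow> ty \<Rightarrow> bool" where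
  exp: "G i = Some s \<Longrightarrow> typing G Map.empty (Var i) s"
| lin: "G i = None \<Longrightarrow> typing G [i \<mapsto> s] (Var i) s"
| lam: "typing (case_nat None G) (case_nat (Some s) D) M t \<Longrightarrow> typing G D (Lam M) (Arr s t)"
| lamb: "typing (case_nat (Some s) G) (case_nat None D) M t \<Longrightarrow>
    typing G D (LamB M) (Arr (Bang s) t)"
| app: "typing G D M (Arr s t) \<Longrightarrow> typing G T N s \<Longrightarrow> dom D \<inter> dom T = {} \<Longrightarrow>
    typing G (D ++ T) (App M N) t"
| box: "typing G Map.empty M s \<Longrightarrow> typing G Map.empty (Box M) (Bang s)"
| choice: "typing G D M s \<Longrightarrow> typing G D N s \<Longrightarrow> typing G D (Choice M N) s"
| por: "typing G D M s \<Longrightarrow> typing G T N s \<Longrightarrow> typing G X L t \<Longrightarrow>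
    dom D \<inter> dom T = {} \<Longrightarrow> dom D \<inter> dom X = {} \<Longrightarrow> dom T \<inter> dom X = {} \<Longrightarrow>
    typing G (D ++ T ++ X) (Por M N L) t"


section \<open>Context distance\<close>

text \<open>The distinguished variable \<open>h\<close> of a context is index 0, its only free variable.\<close>

definition ctx_dist :: "ty \<Rightarrow> trm \<Rightarrow> trm \<Rightarrow> real" where
  "ctx_dist s M N =
    (SUP C \<in> {C. \<exists>t. typing Map.empty [0 \<mapsto> s] C t}.
      \<bar>Obs (subst_trm C 0 M) - Obs (subst_trm C 0 N)\<bar>)"

end

theory Submission imports Defs begin

text \<open>
  Suppose a context \<open>C\<close> separates \<open>!M\<close> and \<open>!N\<close>, with probabilities of convergence \<open>p > q\<close>. The
  hole has type \<open>!\<sigma>\<close>, so it can be opened by a non-linear abstraction and copied, which allows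
  running \<open>C\<close> many times. Since \<open>por(A, B, L)\<close> converges with probability
  \<open>(1 - (1 - a)(1 - b)) l\<close>, the term \<open>por(C, C, L)\<close> acts as a conjunction of \<open>L\<close> with a test of
  success probability \<open>f p = 1 - (1 - p)\<^sup>2\<close>, still with \<open>f p > f q\<close>, and \<open>por(A, B, \<lambda>x.x)\<close> is a
  disjunction. A disjunction of \<open>m\<close> conjunctions of \<open>n\<close> tests converges with probability
  \<open>1 - (1 - (f p)\<^sup>n)\<^sup>m\<close>; with \<open>m\<close> a large multiple of \<open>(f p)\<^sup>-\<^sup>n\<close>, this is close to 1 for \<open>M\<close>, and
  it tends to 0 for \<open>N\<close> as \<open>n\<close> grows because \<open>f q / f p < 1\<close>.

  The semantics is a pointwise supremum over all reduction strategies, so relating \<open>Obs\<close> to the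
  masses of approximants needs confluence: any two approximants have a common upper bound.
\<close>

section \<open>Confluence of reduction\<close>

text \<open>A one-element reduct \<open>N\<close> is represented by the pair \<open>N, N\<close>: every step is a fair coin toss.\<close>

inductive bstep :: "trm \<Rightarrow> trm \<Rightarrow> trm \<Rightarrow> bool" where
  choice: "bstep (Choice M N) M N"
| beta_lin: "is_value V \<Longrightarrow> bstep (App (Lam M) V) (subst_trm M 0 V) (subst_trm M 0 V)"
| beta_exp: "bstep (App (LamB M) (Box N)) (subst_trm M 0 N) (subst_trm M 0 N)"
| por_left: "is_value V \<Longrightarrow> bstep (Por V M N) N N"
| por_right: "is_value V \<Longrightarrow> bstep (Por M V N) N N"
| app_fun: "bstep M A B \<Longrightarrow> is_value V \<Longrightarrow> bstep (App M V) (App A V) (App B V)"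
| app_arg: "bstep N A B \<Longrightarrow> bstep (App M N) (App M A) (App M B)"
| por_fst: "bstep M A B \<Longrightarrow> bstep (Por M N L) (Por A N L) (Por B N L)"
| por_snd: "bstep N A B \<Longrightarrow> bstep (Por M N L) (Por M A L) (Por M B L)"

inductive_cases bstep_AppE: "bstep (App M N) A B"
inductive_cases bstep_ChoiceE: "bstep (Choice M N) A B"
inductive_cases bstep_PorE: "bstep (Por M N L) A B"

lemma bstep_not_value: "bstep M A B \<Longrightarrow> \<not> is_value M"
  by (induction rule: bstep.induct) auto

lemma base_step_bstep:
  "base_step M Ns \<Longrightarrow> (\<exists>A B. Ns = [A, B] \<and> bstep M A B) \<or> (\<exists>A. Ns = [A] \<and> bstep M A A)"
  by (induction rule: base_step.induct) (auto intro: bstep.intros)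

lemma bstep_eval_ctx: "eval_ctx E \<Longrightarrow> bstep M A B \<Longrightarrow> bstep (E M) (E A) (E B)"
  by (induction rule: eval_ctx.induct) (auto intro: bstep.intros)

lemma step_bstep:
  "step M Ns \<Longrightarrow> (\<exists>A B. Ns = [A, B] \<and> bstep M A B) \<or> (\<exists>A. Ns = [A] \<and> bstep M A A)"
  by (induction rule: step.induct) (auto dest!: base_step_bstep intro: bstep_eval_ctx)

lemma base_step_step: "base_step M Ns \<Longrightarrow> step M Ns"
  using step.intros[OF _ eval_ctx.hole] by simp

lemma step_eval_ctx:
  assumes "step M Ns" "\<And>E. eval_ctx E \<Longrightarrow> eval_ctx (\<lambda>M. F (E M))"
  shows "step (F M) (map F Ns)"
  using assms(1)
proof cases
  case (1 M0 Ns0 E)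
  then show ?thesis
    using step.intros[OF _ assms(2)[of E], of M0 Ns0] by (simp add: comp_def)
qed

text \<open>Equal reducts do not determine the list: \<open>Choice A A\<close> steps to two copies
  of \<open>A\<close>, a beta redex to a single term.\<close>

lemma bstep_step: "bstep M A B \<Longrightarrow> step M [A, B] \<or> A = B \<and> step M [A]"
proof (induction rule: bstep.induct)
  case (app_fun M A B V)
  then show ?case
    using step_eval_ctx[where F = "\<lambda>x. App x V", OF _ eval_ctx.app_fun] by fastforce
next
  case (app_arg N A B M)
  then show ?case
    using step_eval_ctx[where F = "\<lambda>x. App M x", OF _ eval_ctx.app_arg] by fastforce
next
  case (por_fst M A B N L)
  then show ?case
    using step_eval_ctx[where F = "\<lambda>x. Por x N L", OF _ eval_ctx.por_left] by fastforce
next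
  case (por_snd N A B M L)
  then show ?case
    using step_eval_ctx[where F = "\<lambda>x. Por M x L", OF _ eval_ctx.por_right] by fastforce
qed (auto intro: base_step_step base_step.intros)

text \<open>
  Idle steps make the diamond property hold even when \<open>por\<close> discards an argument that could
  still toss a coin.
\<close>

definition ibstep :: "trm \<Rightarrow> trm \<Rightarrow> trm \<Rightarrow> bool" where
  "ibstep M A B \<longleftrightarrow> bstep M A B \<or> A = M \<and> B = M"

lemma ibstep_idle: "ibstep M M M"
  by (simp add: ibstep_def)

lemma ibstep_cong:
  "ibstep M A B \<Longrightarrow> is_value V \<Longrightarrow> ibstep (App M V) (App A V) (App B V)"
  "ibstep N A B \<Longrightarrow> ibstep (App M N) (App M A) (App M B)"
  "ibstep M A B \<Longrightarrow> ibstep (Por M N L) (Por A N L) (Por B N L)"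
  "ibstep N A B \<Longrightarrow> ibstep (Por M N L) (Por M A L) (Por M B L)"
  by (auto simp: ibstep_def intro: bstep.intros)

text \<open>Read \<open>P\<close>, \<open>Q\<close>, \<open>R\<close>, \<open>S\<close> as a 2x2
  matrix: two tosses made in either order, by rows or by columns, have the same four
  outcomes.\<close>

definition tiles :: "trm \<Rightarrow> trm \<Rightarrow> trm \<Rightarrow> trm \<Rightarrow> bool" where
  "tiles A B A' B' \<longleftrightarrow> (\<exists>P Q R S. ibstep A P Q \<and> ibstep B R S \<and> ibstep A' P R \<and> ibstep B' Q S)"

lemma tiles_sym: "tiles A B A' B' \<Longrightarrow> tiles A' B' A B"
  unfolding tiles_def by blast

lemma tiles_map:
  assumes "tiles A B A' B'" "\<And>M P Q. ibstep M P Q \<Longrightarrow> ibstep (F M) (F P) (F Q)"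
  shows "tiles (F A) (F B) (F A') (F B')"
  using assms unfolding tiles_def by blast

lemma tiles_const: "ibstep A L L \<Longrightarrow> ibstep B L L \<Longrightarrow> tiles L L A B"
  unfolding tiles_def using ibstep_idle by blast

text \<open>Only \<open>Por\<close> lets different redexes compete, because \<open>App\<close>
  evaluates its argument to a value first. The equality alternative covers the same choice fired on
  both sides, whose outcomes need not be joinable.\<close>

lemma bstep_diamond:
  "bstep M A B \<Longrightarrow> bstep M A' B' \<Longrightarrow> A = A' \<and> B = B' \<or> tiles A B A' B'"
proof (induction arbitrary: A' B' rule: bstep.induct)
  case (choice M N)
  then show ?case by (auto elim: bstep_ChoiceE)
next
  case (beta_lin V M)
  then show ?case by (auto elim!: bstep_AppE dest: bstep_not_value)
next
  case (beta_exp M N)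
  then show ?case by (auto elim!: bstep_AppE dest: bstep_not_value)
next
  case (por_left V M N)
  from por_left.prems show ?case
  proof (cases rule: bstep_PorE[consumes 1])
    case (4 A B)
    then show ?thesis using por_left.hyps
      by (auto intro!: tiles_const simp: ibstep_def intro: bstep.por_left)
  qed (use por_left.hyps in \<open>auto dest: bstep_not_value\<close>)
next
  case (por_right V M N)
  from por_right.prems show ?case
  proof (cases rule: bstep_PorE[consumes 1])
    case (3 A B)
    then show ?thesis using por_right.hyps
      by (auto intro!: tiles_const simp: ibstep_def intro: bstep.por_right)
  qed (use por_right.hyps in \<open>auto dest: bstep_not_value\<close>)
next
  case (app_fun M A B V)
  from app_fun.prems show ?case
  proof (cases rule: bstep_AppE[consumes 1])
    case (3 P Q)
    then show ?thesis
      using app_fun.IH[of P Q] tiles_map[where F = "\<lambda>x. App x V", OF _ ibstep_cong(1)] app_fun.hyps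
      by auto
  qed (use app_fun.hyps in \<open>auto dest: bstep_not_value\<close>)
next
  case (app_arg N A B M)
  from app_arg.prems show ?case
  proof (cases rule: bstep_AppE[consumes 1])
    case (4 P Q)
    then show ?thesis
      using app_arg.IH[of P Q] tiles_map[where F = "\<lambda>x. App M x", OF _ ibstep_cong(2)]
      by auto
  qed (use app_arg.hyps in \<open>auto dest: bstep_not_value\<close>)
next
  case (por_fst M A B N L)
  from por_fst.prems show ?case
  proof (cases rule: bstep_PorE[consumes 1])
    case 2
    then show ?thesis using por_fst.hyps
      by (auto intro!: tiles_sym[OF tiles_const] simp: ibstep_def intro: bstep.por_right)
  next
    case (3 P Q)
    then show ?thesis
      using por_fst.IH[of P Q] tiles_map[where F = "\<lambda>x. Por x N L", OF _ ibstep_cong(3)]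
      by auto
  next
    case (4 P Q)
    \<comment> \<open>Redexes in different arguments are independent: each remains available after
      the other has fired.\<close>
    then have "tiles (Por A N L) (Por B N L) (Por M P L) (Por M Q L)"
      using por_fst.hyps unfolding tiles_def ibstep_def by (meson bstep.por_fst bstep.por_snd)
    then show ?thesis using 4 by simp
  qed (use por_fst.hyps in \<open>auto dest: bstep_not_value\<close>)
next
  case (por_snd N A B M L)
  from por_snd.prems show ?case
  proof (cases rule: bstep_PorE[consumes 1])
    case 1
    then show ?thesis using por_snd.hyps
      by (auto intro!: tiles_sym[OF tiles_const] simp: ibstep_def intro: bstep.por_left)
  next
    case (3 P Q)
    then have "tiles (Por M A L) (Por M B L) (Por P N L) (Por Q N L)"
      using por_snd.hyps unfolding tiles_def ibstep_def by (meson bstep.por_fst bstep.por_snd)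
    then show ?thesis using 3 by simp
  next
    case (4 P Q)
    then show ?thesis
      using por_snd.IH[of P Q] tiles_map[where F = "\<lambda>x. Por M x L", OF _ ibstep_cong(4)]
      by auto
  qed (use por_snd.hyps in \<open>auto dest: bstep_not_value\<close>)
qed

lemma tiles_idle: "ibstep M A B \<Longrightarrow> tiles A B M M"
  unfolding tiles_def using ibstep_idle by blast

lemma ibstep_diamond:
  "ibstep M A B \<Longrightarrow> ibstep M A' B' \<Longrightarrow> A = A' \<and> B = B' \<or> tiles A B A' B'"
  using bstep_diamond tiles_idle tiles_sym unfolding ibstep_def by metis

section \<open>Probability of convergence\<close>

text \<open>
  The last argument is the total mass of the distribution. Because of idle steps, these
  approximants are closed under averaging, which the official ones are not; without this, the
  approximants of \<open>L\<close> obtained from the two branches of \<open>por(V, M \<oplus> N, L)\<close> could not be merged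
  in \<open>wapx_commute\<close>.
\<close>

inductive wapx :: "trm \<Rightarrow> (trm \<Rightarrow> real) \<Rightarrow> real \<Rightarrow> bool" where
  val: "is_value V \<Longrightarrow> wapx V (\<lambda>W. if W = V then 1 else 0) 1"
| empty: "wapx M (\<lambda>W. 0) 0"
| step: "ibstep M A B \<Longrightarrow> wapx A D r \<Longrightarrow> wapx B D' r' \<Longrightarrow>
    wapx M (\<lambda>W. (D W + D' W) / 2) ((r + r') / 2)"

lemma wapx_nonneg: "wapx M D r \<Longrightarrow> 0 \<le> D W"
  by (induction rule: wapx.induct) auto

lemma wapx_mass_bounds: "wapx M D r \<Longrightarrow> 0 \<le> r \<and> r \<le> 1"
  by (induction rule: wapx.induct) auto

lemma wapx_le_one: "wapx M D r \<Longrightarrow> D W \<le> 1"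
  by (induction rule: wapx.induct) auto

lemma wapx_value_le:
  "wapx V D r \<Longrightarrow> is_value V \<Longrightarrow> D W \<le> (if W = V then 1 else 0)"
proof (induction rule: wapx.induct)
  case (step M A B D r D' r')
  then have "A = M" "B = M"
    using bstep_not_value unfolding ibstep_def by auto
  with step show ?case by (auto split: if_splits)
qed auto

text \<open>Quantifying over all finite supersets of a support lets the supports of two branches be
  united.\<close>

lemma wapx_mass:
  "wapx M D r \<Longrightarrow>
    \<exists>F. finite F \<and> F \<subseteq> {V. is_value V} \<and> (\<forall>G. finite G \<longrightarrow> F \<subseteq> G \<longrightarrow> sum D G = r)"
proof (induction rule: wapx.induct)
  case (val V)
  then show ?case by (intro exI[of _ "{V}"]) auto
next
  case (empty M)
  then show ?case by (intro exI[of _ "{}"]) auto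
next
  case (step M A B D r D' r')
  then obtain F F' where
    "finite F" "F \<subseteq> {V. is_value V}" "\<And>G. finite G \<Longrightarrow> F \<subseteq> G \<Longrightarrow> sum D G = r"
    "finite F'" "F' \<subseteq> {V. is_value V}" "\<And>G. finite G \<Longrightarrow> F' \<subseteq> G \<Longrightarrow> sum D' G = r'"
    by metis
  then show ?case
    by (intro exI[of _ "F \<union> F'"]) (auto simp: sum.distrib simp flip: sum_divide_distrib)
qed

lemma wapx_sum_le:
  assumes "wapx M D r" "finite G"
  shows "sum D G \<le> r"
proof -
  obtain F where F: "finite F" "\<And>G. finite G \<Longrightarrow> F \<subseteq> G \<Longrightarrow> sum D G = r"
    using wapx_mass[OF assms(1)] by metis
  have "sum D G \<le> sum D (F \<union> G)"
    using F(1) assms wapx_nonneg by (intro sum_mono2) auto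
  also have "\<dots> = r" using F assms by simp
  finally show ?thesis .
qed

text \<open>Any chosen first step can be moved to the front without loss: in the tiled case both
  branches are commuted with the completing steps and the four outcomes are regrouped.\<close>

lemma wapx_commute:
  "wapx M D r \<Longrightarrow> ibstep M A B \<Longrightarrow>
    \<exists>D1 r1 D2 r2. wapx A D1 r1 \<and> wapx B D2 r2 \<and> (\<forall>W. D W \<le> (D1 W + D2 W) / 2)"
proof (induction arbitrary: A B rule: wapx.induct)
  case (val V)
  then have "A = V" "B = V"
    using bstep_not_value unfolding ibstep_def by auto
  then show ?case using wapx.val[OF val.hyps] by fastforce
next
  case (empty M)
  then show ?case using wapx.empty by fastforce
next
  case (step M A' B' D r D' r')
  from ibstep_diamond[OF step.prems step.hyps(1)] show ?case
  proof
    assume "A = A' \<and> B = B'"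
    then show ?thesis using step.hyps by blast
  next
    assume "tiles A B A' B'"
    then obtain P Q R S where *: "ibstep A P Q" "ibstep B R S" "ibstep A' P R" "ibstep B' Q S"
      unfolding tiles_def by blast
    obtain D1 r1 D2 r2 where 1: "wapx P D1 r1" "wapx R D2 r2" "\<And>W. D W \<le> (D1 W + D2 W) / 2"
      using step.IH(1)[OF *(3)] by blast
    obtain E1 s1 E2 s2 where 2: "wapx Q E1 s1" "wapx S E2 s2" "\<And>W. D' W \<le> (E1 W + E2 W) / 2"
      using step.IH(2)[OF *(4)] by blast
    have "(D W + D' W) / 2 \<le> ((D1 W + E1 W) / 2 + (D2 W + E2 W) / 2) / 2" for W
      using 1(3)[of W] 2(3)[of W] by (simp add: field_simps)
    then show ?thesis
      using wapx.step[OF *(1) 1(1) 2(1)] wapx.step[OF *(2) 1(2) 2(2)] by blast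
  qed
qed

text \<open>The second approximation is commuted with the leading step of the first; then the two
  are joined branch by branch.\<close>

lemma wapx_directed:
  "wapx M D r \<Longrightarrow> wapx M E s \<Longrightarrow> \<exists>D' r'. wapx M D' r' \<and> (\<forall>W. D W \<le> D' W \<and> E W \<le> D' W)"
proof (induction arbitrary: E s rule: wapx.induct)
  case (val V)
  then show ?case using wapx.val wapx_value_le by blast
next
  case (empty M)
  then show ?case using wapx_nonneg by blast
next
  case (step M A B D r D' r')
  obtain E1 s1 E2 s2 where E: "wapx A E1 s1" "wapx B E2 s2" "\<And>W. E W \<le> (E1 W + E2 W) / 2"
    using wapx_commute[OF step.prems step.hyps(1)] by blast
  obtain D1 r1 where 1: "wapx A D1 r1" "\<And>W. D W \<le> D1 W" "\<And>W. E1 W \<le> D1 W"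
    using step.IH(1)[OF E(1)] by blast
  obtain D2 r2 where 2: "wapx B D2 r2" "\<And>W. D' W \<le> D2 W" "\<And>W. E2 W \<le> D2 W"
    using step.IH(2)[OF E(2)] by blast
  have "(D W + D' W) / 2 \<le> (D1 W + D2 W) / 2 \<and> E W \<le> (D1 W + D2 W) / 2" for W
    using 1(2,3)[of W] 2(2,3)[of W] E(3)[of W] by simp
  then show ?case using wapx.step[OF step.hyps(1) 1(1) 2(1)] by blast
qed

section \<open>Comparison with the approximants of the official semantics\<close>

lemma approx_wapx: "approx M D \<Longrightarrow> \<exists>r. wapx M D r"
proof (induction rule: approx.induct)
  case (val V)
  then show ?case using wapx.val by blast
next
  case (empty M)
  then show ?case using wapx.empty by blast
next
  case (step M Ns Ds)
  from step_bstep[OF step.hyps(1)] show ?case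
  proof
    assume "\<exists>A B. Ns = [A, B] \<and> bstep M A B"
    then obtain A B where *: "Ns = [A, B]" "bstep M A B" by blast
    with step(2) obtain D D' where "Ds = [D, D']" "\<exists>r. wapx A D r" "\<exists>r. wapx B D' r"
      by (auto simp: list_all2_Cons1)
    with * show ?thesis
      using wapx.step[of M A B D _ D'] by (auto simp: ibstep_def add_divide_distrib)
  next
    assume "\<exists>A. Ns = [A] \<and> bstep M A A"
    then obtain A where *: "Ns = [A]" "bstep M A A" by blast
    with step(2) obtain D where "Ds = [D]" "\<exists>r. wapx A D r"
      by (auto simp: list_all2_Cons1)
    with * show ?thesis
      using wapx.step[of M A A D _ D] by (auto simp: ibstep_def)
  qed
qed

text \<open>The value \<open>W\<close> is fixed because two official approximants of one term cannot
  be averaged, but the one larger at \<open>W\<close> can be kept.\<close>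

lemma wapx_approx: "wapx M D r \<Longrightarrow> \<exists>D'. approx M D' \<and> D W \<le> D' W"
proof (induction rule: wapx.induct)
  case (val V)
  then show ?case using approx.val by blast
next
  case (empty M)
  then show ?case using approx.empty by blast
next
  case (step M A B D r D' r')
  then obtain E E' where E: "approx A E" "D W \<le> E W" "approx B E'" "D' W \<le> E' W" by blast
  from step.hyps(1) consider "step M [A, B]" | "A = B" "step M [A]" | "A = M" "B = M"
    using bstep_step unfolding ibstep_def by blast
  then show ?case
  proof cases
    case 1
    have "approx M (\<lambda>W. \<Sum>D\<leftarrow>[E, E']. 1 / real (length [A, B]) * D W)"
      using E by (intro approx.step[OF 1]) simp
    then show ?thesis using E by (intro exI conjI) (assumption, simp)
  next
    case 2
    obtain E'' where E'': "approx A E''" "E W \<le> E'' W" "E' W \<le> E'' W"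
      using E 2 by (metis linear)
    have "approx M (\<lambda>W. \<Sum>D\<leftarrow>[E'']. 1 / real (length [A]) * D W)"
      using E'' by (intro approx.step[OF 2(2)]) simp
    then show ?thesis using E E'' by (intro exI conjI) (assumption, simp)
  next
    case 3
    obtain E'' where E'': "approx M E''" "E W \<le> E'' W" "E' W \<le> E'' W"
      using E 3 by (metis linear)
    then show ?thesis using E by (intro exI[of _ E'']) simp
  qed
qed

lemma wapx_le_sem: "wapx M D r \<Longrightarrow> D W \<le> sem M W"
proof -
  assume "wapx M D r"
  then obtain D' where D': "approx M D'" "D W \<le> D' W" using wapx_approx by blast
  have "bdd_above ((\<lambda>D. D W) ` {D. approx M D})"
    by (auto intro!: bdd_aboveI2[of _ _ 1] dest!: approx_wapx dest: wapx_le_one)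
  then have "D' W \<le> sem M W"
    unfolding sem_def using D' by (intro cSUP_upper) auto
  with D' show ?thesis by simp
qed

lemma sem_leI: "(\<And>D r. wapx M D r \<Longrightarrow> D W \<le> c) \<Longrightarrow> sem M W \<le> c"
  unfolding sem_def
  by (intro cSUP_least) (use approx.empty in \<open>auto dest!: approx_wapx\<close>)

lemma sem_nonneg: "0 \<le> sem M W"
  using wapx_le_sem[OF wapx.empty] .

section \<open>Total masses and their agreement with \<open>Obs\<close>\<close>

definition conv :: "trm \<Rightarrow> real" where
  "conv M = Sup {r. \<exists>D. wapx M D r}"

lemma conv_upper: "wapx M D r \<Longrightarrow> r \<le> conv M"
  unfolding conv_def
  by (intro cSup_upper) (auto intro!: bdd_aboveI[of _ 1] dest: wapx_mass_bounds)

lemma conv_leI: "(\<And>D r. wapx M D r \<Longrightarrow> r \<le> c) \<Longrightarrow> conv M \<le> c"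
  unfolding conv_def by (intro cSup_least) (use wapx.empty in blast)+

lemma conv_bounds: "0 \<le> conv M" "conv M \<le> 1"
  using conv_upper[OF wapx.empty] conv_leI wapx_mass_bounds by auto

lemma conv_value: "is_value V \<Longrightarrow> conv V = 1"
  using conv_upper[OF wapx.val] conv_bounds(2)[of V] by fastforce

text \<open>Carries a bound on masses to their supremum; formulas in several arguments take one such
  passage per argument.\<close>

lemma conv_affine_leI:
  assumes "0 \<le> k" "\<And>D r. wapx M D r \<Longrightarrow> k * r + d \<le> c"
  shows "k * conv M + d \<le> c"
proof (cases "k = 0")
  case True
  then show ?thesis using assms(2)[OF wapx.empty] by simp
next
  case False
  with assms have k: "0 < k" by simp
  have "conv M \<le> (c - d) / k"
    using assms(2) k by (intro conv_leI) (simp add: field_simps)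
  then show ?thesis using k by (simp add: field_simps)
qed

text \<open>
  The extra summand over \<open>G\<close> lets the suprema in \<open>sem\<close> be taken one value at a time.
\<close>

lemma sum_sem_le_conv:
  "finite F \<Longrightarrow> wapx M D r \<Longrightarrow> finite G \<Longrightarrow> F \<inter> G = {} \<Longrightarrow> sum (sem M) F + sum D G \<le> conv M"
proof (induction arbitrary: D r G rule: finite_induct)
  case empty
  then show ?case using order_trans[OF wapx_sum_le conv_upper] by simp
next
  case (insert V F)
  have "sem M V \<le> conv M - sum (sem M) F - sum D G"
  proof (rule sem_leI)
    fix E s assume "wapx M E s"
    \<comment> \<open>Directedness absorbs \<open>E\<close> into \<open>D\<close>, so that
      \<open>V\<close> can be moved to the residual set \<open>G\<close>.\<close>
    from wapx_directed[OF insert.prems(1) this] obtain D' r' where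
      D': "wapx M D' r'" "\<And>W. D W \<le> D' W" "\<And>W. E W \<le> D' W"
      by blast
    have "sum (sem M) F + sum D' (Set.insert V G) \<le> conv M"
      using insert by (intro insert.IH[OF D'(1)]) auto
    moreover have "sum D' (Set.insert V G) = D' V + sum D' G"
      using insert by simp
    moreover have "sum D G \<le> sum D' G" by (intro sum_mono D')
    ultimately show "E V \<le> conv M - sum (sem M) F - sum D G"
      using D'(3)[of V] by linarith
  qed
  then show ?case using insert by simp
qed

lemma Obs_eq_conv: "Obs M = conv M"
proof (rule antisym)
  have le: "sum (sem M) F \<le> conv M" if "finite F" for F
    using sum_sem_le_conv[OF that wapx.empty, of "{}"] by simp
  have summable: "sem M summable_on {V. is_value V}"
    by (intro nonneg_bdd_above_summable_on bdd_aboveI2[of _ _ "conv M"])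
       (auto intro: le sem_nonneg)
  show "Obs M \<le> conv M"
    unfolding Obs_def by (intro infsum_le_finite_sums summable le)
  show "conv M \<le> Obs M"
  proof (rule conv_leI)
    fix D r assume D: "wapx M D r"
    then obtain F where F: "finite F" "F \<subseteq> {V. is_value V}" "sum D F = r"
      using wapx_mass[OF D] by (metis order_refl)
    have "r \<le> sum (sem M) F"
      using F(3) wapx_le_sem[OF D] by (auto intro: sum_mono)
    also have "\<dots> \<le> Obs M"
      unfolding Obs_def by (intro finite_sum_le_infsum summable F sem_nonneg)
    finally show "r \<le> Obs M" .
  qed
qed

text \<open>Approximants of the two branches are chosen independently, so the suprema are taken in
  turn.\<close>

lemma conv_step_ge:
  assumes "ibstep M A B"
  shows "(conv A + conv B) / 2 \<le> conv M"
proof -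
  have "1/2 * conv B + 1/2 * conv A \<le> conv M"
  proof (rule conv_affine_leI)
    fix D r assume B: "wapx B D r"
    have "1/2 * conv A + 1/2 * r \<le> conv M"
    proof (rule conv_affine_leI)
      fix D' r' assume "wapx A D' r'"
      from conv_upper[OF wapx.step[OF assms this B]]
      show "1/2 * r' + 1/2 * r \<le> conv M" by (simp add: add_divide_distrib)
    qed simp
    then show "1/2 * r + 1/2 * conv A \<le> conv M" by simp
  qed simp
  then show ?thesis by (simp add: add_divide_distrib)
qed

section \<open>Convergence of beta redexes and of parallel disjunction\<close>

text \<open>Function and argument are both values, so apart from idling only the beta step is
  possible.\<close>

lemma conv_beta_exp: "conv (App (LamB B) (Box M)) = conv (subst_trm B 0 M)"
proof (rule antisym)
  have "r \<le> conv (subst_trm B 0 M)" if "wapx (App (LamB B) (Box M)) D r" for D r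
    using that
  proof (induction "App (LamB B) (Box M)" D r rule: wapx.induct)
    case (step A A' D r D' r')
    from step.hyps(1) consider "A = subst_trm B 0 M" "A' = subst_trm B 0 M"
      | "A = App (LamB B) (Box M)" "A' = App (LamB B) (Box M)"
      unfolding ibstep_def by (auto elim!: bstep_AppE dest: bstep_not_value)
    then show ?case
    proof cases
      case 1
      then show ?thesis
        using conv_upper[OF step.hyps(2)] conv_upper[OF step.hyps(4)] by simp
    next
      case 2
      then show ?thesis using step.hyps(3,5) by simp
    qed
  qed (auto intro: conv_bounds)
  then show "conv (App (LamB B) (Box M)) \<le> conv (subst_trm B 0 M)" by (rule conv_leI)
  show "conv (subst_trm B 0 M) \<le> conv (App (LamB B) (Box M))"
    using conv_step_ge[of "App (LamB B) (Box M)" "subst_trm B 0 M" "subst_trm B 0 M"]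
    by (simp add: ibstep_def bstep.beta_exp)
qed

lemma wapx_por_snd:
  "wapx B D b \<Longrightarrow> wapx L E l \<Longrightarrow> \<exists>D'. wapx (Por A B L) D' (b * l)"
proof (induction rule: wapx.induct)
  case (val V)
  then have "ibstep (Por A V L) L L" by (simp add: ibstep_def bstep.por_right)
  from wapx.step[OF this val.prems val.prems] show ?case by auto
next
  case (empty M)
  then show ?case using wapx.empty by auto
next
  case (step M M1 M2 D r D' r')
  then obtain E1 E2 where "wapx (Por A M1 L) E1 (r * l)" "wapx (Por A M2 L) E2 (r' * l)"
    by blast
  from wapx.step[OF ibstep_cong(4)[OF step.hyps(1)] this]
  show ?case by (auto simp: field_simps)
qed

text \<open>The strategy runs \<open>A\<close> first; the unfinished mass \<open>1 - a\<close> falls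
  through to \<open>B\<close> by \<open>wapx_por_snd\<close>, and success of either releases
  \<open>L\<close>.\<close>

lemma wapx_por:
  "wapx A D a \<Longrightarrow> wapx B D'' b \<Longrightarrow> wapx L E l \<Longrightarrow>
    \<exists>D'. wapx (Por A B L) D' ((1 - (1 - a) * (1 - b)) * l)"
proof (induction rule: wapx.induct)
  case (val V)
  then have "ibstep (Por V B L) L L" by (simp add: ibstep_def bstep.por_left)
  from wapx.step[OF this val.prems(2) val.prems(2)] show ?case by auto
next
  case (empty M)
  then show ?case using wapx_por_snd by auto
next
  case (step M M1 M2 D r D' r')
  then obtain E1 E2 where
    "wapx (Por M1 B L) E1 ((1 - (1 - r) * (1 - b)) * l)"
    "wapx (Por M2 B L) E2 ((1 - (1 - r') * (1 - b)) * l)"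
    by blast
  from wapx.step[OF ibstep_cong(3)[OF step.hyps(1)] this]
  show ?case by (auto simp: field_simps)
qed

lemma or_mono:
  fixes a b :: real
  assumes "a \<le> a'" "b \<le> b'" "a' \<le> 1" "b' \<le> 1" "0 \<le> l"
  shows "(1 - (1 - a) * (1 - b)) * l \<le> (1 - (1 - a') * (1 - b')) * l"
  using assms by (intro mult_right_mono) (auto intro!: mult_mono)

text \<open>The bound is affine in \<open>conv A\<close> and in \<open>conv B\<close> separately, so
  it survives averaging over the branches of one argument; \<open>conv_step_ge\<close> then returns
  to the unreduced argument.\<close>

lemma wapx_por_le:
  "wapx (Por A B L) D r \<Longrightarrow> r \<le> (1 - (1 - conv A) * (1 - conv B)) * conv L"
proof (induction "Por A B L" D r arbitrary: A B rule: wapx.induct)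
  case (empty A B)
  then show ?case using or_mono[of 0 "conv A" 0 "conv B" "conv L"] conv_bounds by auto
next
  case (step P Q D r D' r')
  note b = conv_bounds[of A] conv_bounds[of B] conv_bounds[of L]
  from step.hyps(1) consider "P = L" "Q = L" "is_value A \<or> is_value B"
    | A1 A2 where "bstep A A1 A2" "P = Por A1 B L" "Q = Por A2 B L"
    | B1 B2 where "bstep B B1 B2" "P = Por A B1 L" "Q = Por A B2 L"
    | "P = Por A B L" "Q = Por A B L"
    unfolding ibstep_def by (auto elim!: bstep_PorE)
  then show ?case
  proof cases
    case 1
    then have eq: "(1 - (1 - conv A) * (1 - conv B)) * conv L = conv L"
      using conv_value by auto
    show ?thesis
      unfolding eq using 1 conv_upper[OF step.hyps(2)] conv_upper[OF step.hyps(4)] by simp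
  next
    case 2
    have "(r + r') / 2 \<le> (1 - (1 - (conv A1 + conv A2) / 2) * (1 - conv B)) * conv L"
      using step.hyps(3)[OF 2(2)] step.hyps(5)[OF 2(3)] by (simp add: field_simps)
    also have "\<dots> \<le> (1 - (1 - conv A) * (1 - conv B)) * conv L"
      using 2 b conv_step_ge[of A A1 A2] by (intro or_mono) (auto simp: ibstep_def)
    finally show ?thesis .
  next
    case 3
    have "(r + r') / 2 \<le> (1 - (1 - conv A) * (1 - (conv B1 + conv B2) / 2)) * conv L"
      using step.hyps(3)[OF 3(2)] step.hyps(5)[OF 3(3)] by (simp add: field_simps)
    also have "\<dots> \<le> (1 - (1 - conv A) * (1 - conv B)) * conv L"
      using 3 b conv_step_ge[of B B1 B2] by (intro or_mono) (auto simp: ibstep_def)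
    finally show ?thesis .
  next
    case 4
    then show ?thesis using step.hyps(3)[OF 4(1)] step.hyps(5)[OF 4(2)] by simp
  qed
qed auto

lemma conv_por: "conv (Por A B L) = (1 - (1 - conv A) * (1 - conv B)) * conv L"
proof (rule antisym)
  show "conv (Por A B L) \<le> (1 - (1 - conv A) * (1 - conv B)) * conv L"
    by (intro conv_leI wapx_por_le)
  \<comment> \<open>The suprema over \<open>L\<close>, \<open>B\<close> and \<open>A\<close> are
    taken in this order, each through an affine bound with nonnegative slope.\<close>
  have l: "(1 - (1 - a) * (1 - b)) * conv L \<le> conv (Por A B L)"
    if "wapx A D a" "wapx B E b" for a b D E
  proof -
    have "0 \<le> 1 - (1 - a) * (1 - b)"
      using or_mono[of 0 a 0 b 1] wapx_mass_bounds that by force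
    then have "(1 - (1 - a) * (1 - b)) * conv L + 0 \<le> conv (Por A B L)"
      by (rule conv_affine_leI) (use wapx_por[OF that] conv_upper in fastforce)
    then show ?thesis by simp
  qed
  have b: "(1 - (1 - a) * (1 - conv B)) * conv L \<le> conv (Por A B L)" if "wapx A D a" for a D
  proof -
    have "0 \<le> (1 - a) * conv L"
      using wapx_mass_bounds[OF that] conv_bounds by simp
    then have "((1 - a) * conv L) * conv B + a * conv L \<le> conv (Por A B L)"
      by (rule conv_affine_leI) (use l[OF that] in \<open>auto simp: algebra_simps\<close>)
    then show ?thesis by (simp add: algebra_simps)
  qed
  have "0 \<le> (1 - conv B) * conv L"
    using conv_bounds by simp
  then have "((1 - conv B) * conv L) * conv A + conv B * conv L \<le> conv (Por A B L)"
    by (rule conv_affine_leI) (use b in \<open>auto simp: algebra_simps\<close>)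
  then show "(1 - (1 - conv A) * (1 - conv B)) * conv L \<le> conv (Por A B L)"
    by (simp add: algebra_simps)
qed

section \<open>Amplification\<close>

abbreviation id_trm :: trm where "id_trm \<equiv> Lam (Var 0)"

primrec conj_iter :: "nat \<Rightarrow> trm \<Rightarrow> trm" where
  "conj_iter 0 C = id_trm"
| "conj_iter (Suc n) C = Por C C (conj_iter n C)"

text \<open>A disjunction of zero tests would be a divergent term, so counting starts at one copy;
  hence the exponent \<open>Suc n\<close> in \<open>conv_disj_iter\<close>.\<close>

primrec disj_iter :: "nat \<Rightarrow> trm \<Rightarrow> trm" where
  "disj_iter 0 C = C"
| "disj_iter (Suc n) C = Por C (disj_iter n C) id_trm"

lemma conv_conj_iter: "conv (conj_iter n C) = (1 - (1 - conv C)\<^sup>2) ^ n"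
  by (induction n) (auto simp: conv_por conv_value power2_eq_square)

lemma conv_disj_iter: "conv (disj_iter n C) = 1 - (1 - conv C) ^ Suc n"
  by (induction n) (auto simp: conv_por conv_value)

lemma subst_conj_iter: "subst_trm (conj_iter n C) k S = conj_iter n (subst_trm C k S)"
  by (induction n) auto

lemma subst_disj_iter: "subst_trm (disj_iter n C) k S = disj_iter n (subst_trm C k S)"
  by (induction n) auto

section \<open>Typing of the amplified contexts\<close>

lemma typing_id_trm: "typing G Map.empty id_trm (Arr s s)"
proof (rule typing.lam)
  have "case_nat (Some s) Map.empty = [0 \<mapsto> s]"
    by (auto simp: fun_eq_iff split: nat.splits)
  then show "typing (case_nat None G) (case_nat (Some s) Map.empty) (Var 0) s"
    using typing.lin[of "case_nat None G" 0 s] by simp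
qed

text \<open>An empty linear environment splits into empty parts, which makes it possible to repeat a
  test.\<close>

lemma typing_por_nonlinear:
  "typing G Map.empty A s \<Longrightarrow> typing G Map.empty B s \<Longrightarrow> typing G Map.empty L t \<Longrightarrow>
    typing G Map.empty (Por A B L) t"
  using typing.por[of G Map.empty A s Map.empty B Map.empty L t] by simp

lemma typing_conj_iter:
  "typing G Map.empty C t \<Longrightarrow> typing G Map.empty (conj_iter n C) (Arr s s)"
  by (induction n) (auto intro: typing_id_trm typing_por_nonlinear)

lemma typing_disj_iter:
  "typing G Map.empty C (Arr s s) \<Longrightarrow> typing G Map.empty (disj_iter n C) (Arr s s)"
  by (induction n) (auto intro: typing_id_trm typing_por_nonlinear)

text \<open>
  \<open>bang_at C k\<close> is \<open>C{!x/h}\<close>, where \<open>x\<close> takes over the index \<open>k\<close> of \<open>h\<close>.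
\<close>

primrec bang_at :: "trm \<Rightarrow> nat \<Rightarrow> trm" where
  "bang_at (Var i) k = (if i = k then Box (Var i) else Var i)"
| "bang_at (App M N) k = App (bang_at M k) (bang_at N k)"
| "bang_at (Lam M) k = Lam (bang_at M (Suc k))"
| "bang_at (LamB M) k = LamB (bang_at M (Suc k))"
| "bang_at (Box M) k = Box (bang_at M k)"
| "bang_at (Choice M N) k = Choice (bang_at M k) (bang_at N k)"
| "bang_at (Por M N L) k = Por (bang_at M k) (bang_at N k) (bang_at L k)"

lemma subst_bang_at: "subst_trm (bang_at C k) k M = subst_trm C k (Box M)"
  by (induction C arbitrary: k M) auto

lemma case_nat_upd: "case_nat x (G(k := y)) = (case_nat x G)(Suc k := y)"
  by (auto simp: fun_eq_iff split: nat.splits)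

lemma map_add_upd_None: "(D ++ T)(k := None) = D(k := None) ++ T(k := None)"
  by (auto simp: fun_eq_iff map_add_def split: option.splits)

lemma disjoint_upd_None:
  "dom D \<inter> dom T = {} \<Longrightarrow> dom (D(k := None)) \<inter> dom (T(k := None)) = {}"
  by (auto simp: dom_def disjoint_iff)

lemma map_add_cases:
  assumes "dom D \<inter> dom T = {}" "(D ++ T) k = None \<or> (D ++ T) k = Some s"
  shows "D k = None \<or> D k = Some s" "T k = None \<or> T k = Some s"
  using assms by (auto simp: map_add_def split: option.splits)

text \<open>A linear \<open>h : !s\<close> can be rebuilt as the box of a non-linear
  \<open>x : s\<close>. The alternative \<open>D k = None\<close> is there because splitting a
  linear environment leaves \<open>k\<close> in at most one part.\<close>

lemma typing_bang_at:
  "typing G D C t \<Longrightarrow> G k = None \<Longrightarrow> D k = None \<or> D k = Some (Bang s) \<Longrightarrow>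
    typing (G(k := Some s)) (D(k := None)) (bang_at C k) t"
proof (induction arbitrary: k rule: typing.induct)
  case (exp G i t)
  then have "i \<noteq> k" by auto
  moreover have "Map.empty(k := None) = (Map.empty :: nat \<rightharpoonup> ty)" by simp
  moreover from \<open>i \<noteq> k\<close> exp have "typing (G(k := Some s)) Map.empty (Var i) t"
    by (intro typing.exp) simp
  ultimately show ?case by (simp only: bang_at.simps if_False)
next
  case (lin G i t)
  show ?case
  proof (cases "i = k")
    case True
    with lin have t: "t = Bang s" by simp
    have "typing (G(k := Some s)) Map.empty (Box (Var k)) (Bang s)"
      by (intro typing.box typing.exp) simp
    moreover have "[k \<mapsto> Bang s](k := None) = Map.empty" by simp
    ultimately show ?thesis by (simp only: True t bang_at.simps simp_thms if_True)
  next
    case False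
    then have "[i \<mapsto> t](k := None) = [i \<mapsto> t]" by auto
    moreover from False lin have "typing (G(k := Some s)) [i \<mapsto> t] (Var i) t"
      by (intro typing.lin) simp
    ultimately show ?thesis by (simp only: False bang_at.simps if_False)
  qed
next
  case (lam G t D M u)
  show ?case unfolding bang_at.simps
    by (rule typing.lam, unfold case_nat_upd, rule lam.IH) (use lam.prems in auto)
next
  case (lamb t G D M u)
  show ?case unfolding bang_at.simps
    by (rule typing.lamb, unfold case_nat_upd, rule lamb.IH) (use lamb.prems in auto)
next
  case (app G D M t u T N)
  note c = map_add_cases[OF app.hyps(3) app.prems(2)]
  show ?case unfolding map_add_upd_None bang_at.simps
    by (rule typing.app[OF app.IH(1)[OF app.prems(1) c(1)] app.IH(2)[OF app.prems(1) c(2)]])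
       (intro disjoint_upd_None app.hyps)
next
  case (box G M t)
  have "Map.empty(k := None) = (Map.empty :: nat \<rightharpoonup> ty)" by simp
  with box.IH[OF box.prems] show ?case by (simp only: bang_at.simps typing.box)
next
  case (choice G D M t N)
  show ?case unfolding bang_at.simps
    by (rule typing.choice[OF choice.IH(1)[OF choice.prems] choice.IH(2)[OF choice.prems]])
next
  case (por G D M t T N X L u)
  have d: "dom (D ++ T) \<inter> dom X = {}" using por.hyps by auto
  note c = map_add_cases[OF d por.prems(2)]
  note c' = map_add_cases[OF por.hyps(4) c(1)]
  show ?case unfolding map_add_upd_None bang_at.simps
    by (rule typing.por[OF por.IH(1)[OF por.prems(1) c'(1)] por.IH(2)[OF por.prems(1) c'(2)]
          por.IH(3)[OF por.prems(1) c(2)]])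
       (intro disjoint_upd_None por.hyps)+
qed

text \<open>Free indices of a typable term are declared, so with no declaration from
  \<open>k\<close> on, substitution neither replaces nor renumbers anything.\<close>

lemma subst_typing_fresh:
  "typing G D C t \<Longrightarrow> (\<And>i. k \<le> i \<Longrightarrow> G i = None \<and> D i = None) \<Longrightarrow> subst_trm C k S = C"
proof (induction arbitrary: k S rule: typing.induct)
  case (lin G i t)
  from lin.prems[of i] have "i < k" by (cases "k \<le> i") auto
  then show ?case by simp
next
  case (exp G i t)
  with exp.prems[of i] have "i < k" by (cases "k \<le> i") auto
  then show ?case by simp
next
  case (lam G t D M u)
  have "subst_trm M (Suc k) (lift_trm S 0) = M"
    by (rule lam.IH) (use lam.prems in \<open>auto split: nat.splits\<close>)
  then show ?case by simp
next
  case (lamb t G D M u)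
  have "subst_trm M (Suc k) (lift_trm S 0) = M"
    by (rule lamb.IH) (use lamb.prems in \<open>auto split: nat.splits\<close>)
  then show ?case by simp
qed auto

section \<open>Choice of the number of tests\<close>

text \<open>With \<open>m\<close> near \<open>K / a ^ n\<close>, all \<open>Suc m\<close>
  conjunctions fail with probability at most \<open>exp (- K)\<close>, while for \<open>b\<close>
  one of them succeeds with probability at most \<open>Suc m * b ^ n\<close>, which is of order
  \<open>(b / a) ^ n\<close>.\<close>

lemma amplification_bounds:
  fixes a b e :: real
  assumes "0 \<le> b" "b < a" "a \<le> 1" "0 < e"
  shows "\<exists>n m. (1 - a ^ n) ^ Suc m \<le> e \<and> 1 - (1 - b ^ n) ^ Suc m \<le> e"
proof -
  \<comment> \<open>Truncation at 0 keeps \<open>K / a ^ n\<close> nonnegative when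
    \<open>e > 1\<close>, so that \<open>nat\<close> does not distort the ceiling.\<close>
  define K where "K = max 0 (- ln e)"
  have "exp (- K) \<le> exp (ln e)" unfolding exp_le_cancel_iff K_def by simp
  then have K: "0 \<le> K" "exp (- K) \<le> e"
    using assms by (auto simp: K_def)
  have a: "0 < a" using assms by simp
  \<comment> \<open>The summand \<open>2 * b ^ n\<close> pays for the rounding in \<open>m\<close>
    and for the successor in \<open>Suc m\<close>.\<close>
  have "(\<lambda>n. K * (b / a) ^ n + 2 * b ^ n) \<longlonglongrightarrow> K * 0 + 2 * 0"
    using assms a by (intro tendsto_intros LIMSEQ_power_zero) auto
  then have "eventually (\<lambda>n. K * (b / a) ^ n + 2 * b ^ n < e) sequentially"
    using assms by (intro order_tendstoD(2)) auto
  then obtain n where n: "K * (b / a) ^ n + 2 * b ^ n < e"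
    using eventually_happens by fastforce
  define m where "m = nat \<lceil>K / a ^ n\<rceil>"
  have m: "K / a ^ n \<le> real m" "real m \<le> K / a ^ n + 1"
    using K a unfolding m_def by (auto simp: of_nat_nat)
  have an: "0 < a ^ n" "a ^ n \<le> 1" using a assms by (auto intro: power_le_one)
  have bn: "0 \<le> b ^ n" "b ^ n \<le> 1" using assms by (auto intro: power_le_one)
  have "(1 - a ^ n) ^ Suc m \<le> exp (- (a ^ n)) ^ Suc m"
    using an exp_ge_add_one_self[of "- (a ^ n)"] by (intro power_mono) auto
  also have "\<dots> = exp (- (real (Suc m) * a ^ n))"
    by (simp only: exp_of_nat_mult[symmetric] mult_minus_right)
  also have "\<dots> \<le> exp (- K)"
  proof -
    have "K \<le> real m * a ^ n" using m(1) an by (simp add: field_simps)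
    also have "\<dots> \<le> real (Suc m) * a ^ n" using an by simp
    finally show ?thesis by simp
  qed
  also have "\<dots> \<le> e" by (rule K)
  finally have 1: "(1 - a ^ n) ^ Suc m \<le> e" .
  \<comment> \<open>Bernoulli's inequality serves as the union bound.\<close>
  have "1 - real (Suc m) * b ^ n \<le> (1 - b ^ n) ^ Suc m"
    using Bernoulli_inequality[of "- (b ^ n)" "Suc m"] bn by simp
  moreover have "real (Suc m) * b ^ n \<le> (K / a ^ n + 2) * b ^ n"
    using m(2) bn by (intro mult_right_mono) auto
  moreover have "(K / a ^ n + 2) * b ^ n = K * (b / a) ^ n + 2 * b ^ n"
    by (simp add: power_divide field_simps)
  ultimately have "1 - (1 - b ^ n) ^ Suc m \<le> e" using n by linarith
  with 1 show ?thesis by blast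
qed

lemma context_amplification:
  assumes "typing Map.empty [0 \<mapsto> Bang s] C t" and "0 < e"
    and lt: "conv (subst_trm C 0 (Box N)) < conv (subst_trm C 0 (Box M))"
  shows "\<exists>C' t'. typing Map.empty [0 \<mapsto> Bang s] C' t' \<and>
    1 - e \<le> conv (subst_trm C' 0 (Box M)) \<and> conv (subst_trm C' 0 (Box N)) \<le> e"
proof -
  \<comment> \<open>\<open>f x\<close> is the probability that one of two copies of a test
    converges; it is strictly increasing on [0, 1].\<close>
  define f where "f = (\<lambda>x::real. 1 - (1 - x)\<^sup>2)"
  let ?p = "conv (subst_trm C 0 (Box M))" and ?q = "conv (subst_trm C 0 (Box N))"
  have "0 \<le> f ?q"
    using conv_bounds unfolding f_def by (simp add: power_le_one)
  moreover have "f ?q < f ?p"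
    using lt conv_bounds unfolding f_def by (simp add: power_strict_mono)
  moreover have "f ?p \<le> 1" unfolding f_def by simp
  ultimately obtain n m where nm: "(1 - f ?p ^ n) ^ Suc m \<le> e" "1 - (1 - f ?q ^ n) ^ Suc m \<le> e"
    using amplification_bounds \<open>0 < e\<close> by blast
  define B where "B = disj_iter m (conj_iter n (bang_at C 0))"
  \<comment> \<open>The linear hole occurs once, as the argument; its content is shared non-linearly
    by all copies of the test inside \<open>B\<close>.\<close>
  let ?C = "App (LamB B) (Var 0)"
  have "typing (Map.empty(0 := Some s)) ([0 \<mapsto> Bang s](0 := None)) (bang_at C 0) t"
    using assms(1) by (intro typing_bang_at) auto
  then have B: "typing [0 \<mapsto> s] Map.empty B (Arr s s)"
    unfolding B_def by (intro typing_disj_iter typing_conj_iter) simp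
  have "case_nat (Some s) Map.empty = [0 \<mapsto> s]" "case_nat None Map.empty = (Map.empty :: nat \<rightharpoonup> ty)"
    by (auto simp: fun_eq_iff split: nat.splits)
  then have "typing Map.empty Map.empty (LamB B) (Arr (Bang s) (Arr s s))"
    using typing.lamb[of s Map.empty Map.empty B "Arr s s"] B by metis
  then have "typing Map.empty (Map.empty ++ [0 \<mapsto> Bang s]) ?C (Arr s s)"
    by (intro typing.app[OF _ typing.lin]) auto
  then have "typing Map.empty [0 \<mapsto> Bang s] ?C (Arr s s)" by simp
  moreover have "conv (subst_trm ?C 0 (Box L)) =
      1 - (1 - f (conv (subst_trm C 0 (Box L))) ^ n) ^ Suc m" for L
  proof -
    \<comment> \<open>Only the bound index 0 can be free in \<open>B\<close>, so filling the hole
      changes only the argument.\<close>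
    have "subst_trm B (Suc 0) S = B" for S
      by (rule subst_typing_fresh[OF B]) auto
    then have "conv (subst_trm ?C 0 (Box L)) = conv (subst_trm B 0 L)"
      by (simp add: conv_beta_exp)
    then show ?thesis
      unfolding B_def f_def
      by (simp only: subst_disj_iter subst_conj_iter subst_bang_at conv_disj_iter conv_conj_iter)
  qed
  ultimately show ?thesis using nm by (intro exI[of _ ?C] exI[of _ "Arr s s"]) simp
qed

theorem theorem2:
  fixes \<sigma> :: ty and M N :: trm
  assumes "closed_trm M" and "closed_trm N"
    and "typing Map.empty Map.empty M \<sigma>" and "typing Map.empty Map.empty N \<sigma>"
  shows "ctx_dist (Bang \<sigma>) (Box M) (Box N) \<in> {0, 1}"
proof -
  let ?T = "{C. \<exists>t. typing Map.empty [0 \<mapsto> Bang \<sigma>] C t}"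
  let ?d = "\<lambda>C. \<bar>conv (subst_trm C 0 (Box M)) - conv (subst_trm C 0 (Box N))\<bar>"
  have dist: "ctx_dist (Bang \<sigma>) (Box M) (Box N) = (SUP C \<in> ?T. ?d C)"
    unfolding ctx_dist_def Obs_eq_conv ..
  have ne: "?T \<noteq> {}"
    using typing.lin[of Map.empty 0 "Bang \<sigma>"] by blast
  have le: "?d C \<le> 1" for C
    using conv_bounds[of "subst_trm C 0 (Box M)"] conv_bounds[of "subst_trm C 0 (Box N)"] by linarith
  show ?thesis
  proof (cases "\<forall>C\<in>?T. ?d C = 0")
    case True
    then have "(SUP C \<in> ?T. ?d C) = (SUP C \<in> ?T. 0)" by (intro SUP_cong) auto
    then show ?thesis using ne dist by simp
  next
    case False
    then obtain C t where C: "typing Map.empty [0 \<mapsto> Bang \<sigma>] C t" "?d C \<noteq> 0" by blast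
    \<comment> \<open>Either of \<open>M\<close> and \<open>N\<close> may be the more convergent
      one; the amplified gap is at least \<open>(1 - e) - e\<close>.\<close>
    have amp: "\<exists>C'\<in>?T. 1 - 2 * e \<le> ?d C'" if "0 < e" for e
    proof (cases "conv (subst_trm C 0 (Box N)) < conv (subst_trm C 0 (Box M))")
      case True
      from context_amplification[OF C(1) that this] show ?thesis by force
    next
      case False
      with C(2) have "conv (subst_trm C 0 (Box M)) < conv (subst_trm C 0 (Box N))" by simp
      from context_amplification[OF C(1) that this] show ?thesis by force
    qed
    have "1 - 2 * e \<le> (SUP C \<in> ?T. ?d C)" if "0 < e" for e
    proof -
      obtain C' where "C' \<in> ?T" "1 - 2 * e \<le> ?d C'"
        using amp[OF \<open>0 < e\<close>] by blast
      then show ?thesis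
        using le by (intro cSUP_upper2[where x = C'] bdd_aboveI2[of _ _ 1])
    qed
    \<comment> \<open>Applied with \<open>e / 2\<close>, so that the loss is exactly
      \<open>e\<close>.\<close>
    from this[OF half_gt_zero] have "1 \<le> (SUP C \<in> ?T. ?d C) + e" if "0 < e" for e
      using that by fastforce
    then have "1 \<le> (SUP C \<in> ?T. ?d C)" by (rule field_le_epsilon)
    moreover have "(SUP C \<in> ?T. ?d C) \<le> 1"
      using ne le by (intro cSUP_least) auto
    ultimately show ?thesis using dist by simp
  qed
qed

end
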